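(* Let $d\geq 2$ and $n\geq 1$ be integers. If a non-basic subset $M\subset[n]^d$ is minimal, then the non-trivial annihilation function of $M$ is unique up to multiplication by a constant: for any two annihilation functions $f,g$ of $M$ that are not identically zero, there exists a constant $c\in\mathbb{R}$ such that $g=cf$.
   Context: Notation: $[n]=\{1,\ldots,n\}$. A finite subset $M\subset\mathbb{R}^d$ (in particular, a subset $M\subset[n]^d$) is called basic if for any function $f\colon M\to\mathbb{R}$ there exist functions $f_1,\ldots,f_d\colon\mathbb{R}\to\mathbb{R}$ such that $f(x_1,\ldots,x_d)=f_1(x_1)+\ldots+f_d(x_d)$ for every $(x_1,\ldots,x_d)\in M$; otherwise it is non-basic. A non-basic subset $M\subset[n]^d$ is called minimal if every proper subset $K\subsetneq M$ is basic. A layer of $[n]^d$ is a hyperplane given by an equation $x_i=j$ with $i\in[d]$, $j\in[n]$. An annihilation function of $M\subset[n]^d$ is a function $f\colon M\to\mathbb{Z}$ such that $\sum_{x\in L\cap M} f(x)=0$ for each layer $L$. *)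

theory Defs
  imports "HOL-Analysis.Finite_Cartesian_Product"
begin

text \<open>
  The space of dimension $d$ is rendered as \<^typ>\<open>real ^ 'd\<close> for a finite index type \<open>'d\<close>
  with \<open>d = CARD('d)\<close>.  Functions whose domain is a set \<open>M\<close> are rendered as total functions
  of which only the values on \<open>M\<close> are ever used.
\<close>

definition grid :: "nat \<Rightarrow> (real ^ 'd) set"
  where "grid n = {x. \<forall>i. x $ i \<in> real ` {1..n}}"

text \<open>Only used for finite sets; every subset of a grid is finite.\<close>

definition basic :: "(real ^ 'd) set \<Rightarrow> bool"
  where "basic M \<longleftrightarrow>
    (\<forall>f :: real ^ 'd \<Rightarrow> real. \<exists>g :: 'd \<Rightarrow> real \<Rightarrow> real.
       \<forall>x\<in>M. f x = (\<Sum>i\<in>UNIV. g i (x $ i)))"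

definition minimal_nonbasic :: "(real ^ 'd) set \<Rightarrow> bool"
  where "minimal_nonbasic M \<longleftrightarrow> \<not> basic M \<and> (\<forall>K. K \<subset> M \<longrightarrow> basic K)"

definition layers :: "nat \<Rightarrow> (real ^ 'd) set set"
  where "layers n = {{x. x $ i = real j} | i j. j \<in> {1..n}}"

definition annihilation :: "nat \<Rightarrow> (real ^ 'd) set \<Rightarrow> (real ^ 'd \<Rightarrow> int) \<Rightarrow> bool"
  where "annihilation n M f \<longleftrightarrow> (\<forall>L\<in>layers n. (\<Sum>x\<in>L \<inter> M. f x) = 0)"

end

theory Submission
  imports Defs
begin

text \<open>
  On a basic set the zero function is the only annihilation function.  Indeed, a function that
  annihilates every layer is orthogonal to every function depending on a single coordinate, hence
  to every sum of such functions; on a basic set these sums are all the functions, so an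
  annihilation function is orthogonal to itself.  This is \<open>annihilation_basic_eq_0\<close>.

  Now let \<open>f\<close> and \<open>g\<close> annihilate a minimal non-basic set \<open>M\<close>, and let \<open>f a \<noteq> 0\<close>.  The combination
  \<open>f a * g - g a * f\<close> annihilates \<open>M\<close> and vanishes at \<open>a\<close>, so it annihilates \<open>M - {a}\<close> as well.
  By minimality that set is basic, so the combination is zero and \<open>g = (g a / f a) * f\<close>.
\<close>

lemma finite_grid: "finite (grid n :: (real ^ 'd) set)"
proof (rule finite_imageD)
  have "finite (UNIV \<rightarrow>\<^sub>E real ` {1..n} :: ('d \<Rightarrow> real) set)"
    by (rule finite_PiE) auto
  then show "finite (($) ` (grid n :: (real ^ 'd) set))"
    by (rule rev_finite_subset) (auto simp: grid_def PiE_def)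
  show "inj_on ($) (grid n :: (real ^ 'd) set)"
    by (rule inj_onI) (simp add: vec_eq_iff fun_eq_iff)
qed

lemma annihilation_linear_combination:
  assumes "annihilation n M f" and "annihilation n M g"
  shows "annihilation n M (\<lambda>x. p * f x + q * g x)"
  using assms by (simp add: annihilation_def sum.distrib flip: sum_distrib_left)

lemma annihilation_remove_zero:
  assumes "finite M" and "annihilation n M f" and "f a = 0"
  shows "annihilation n (M - {a}) f"
proof -
  have "(\<Sum>x\<in>L \<inter> (M - {a}). f x) = (\<Sum>x\<in>L \<inter> M. f x)" for L
    using assms by (intro sum.mono_neutral_left) auto
  then show ?thesis
    using assms by (simp add: annihilation_def)
qed

text \<open>
  A function of one coordinate is constant on each layer orthogonal to that coordinate, and the
  set is partitioned by these layers.
\<close>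

lemma annihilation_orthogonal_coordinate:
  fixes K :: "(real ^ 'd) set" and u :: "real \<Rightarrow> real"
  assumes "K \<subseteq> grid n" and "annihilation n K h"
  shows "(\<Sum>x\<in>K. real_of_int (h x) * u (x $ i)) = 0"
proof -
  have fin: "finite K"
    using assms(1) finite_grid finite_subset by blast
  have layer: "(\<Sum>x | x \<in> K \<and> x $ i = t. real_of_int (h x) * u (x $ i)) = 0"
    if t: "t \<in> real ` {1..n}" for t
  proof -
    have "{x. x $ i = t} \<in> layers n"
      using t unfolding layers_def by blast
    then have "(\<Sum>x\<in>{x. x $ i = t} \<inter> K. h x) = 0"
      using assms(2) by (simp add: annihilation_def)
    moreover have "{x. x $ i = t} \<inter> K = {x. x \<in> K \<and> x $ i = t}"
      by auto
    ultimately have "(\<Sum>x | x \<in> K \<and> x $ i = t. real_of_int (h x)) = 0"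
      by (simp flip: of_int_sum)
    then show ?thesis
      by (simp flip: sum_distrib_right)
  qed
  have "(\<Sum>x\<in>K. real_of_int (h x) * u (x $ i))
      = (\<Sum>t\<in>real ` {1..n}. \<Sum>x | x \<in> K \<and> x $ i = t. real_of_int (h x) * u (x $ i))"
    using assms(1) fin by (intro sum.group[symmetric]) (auto simp: grid_def)
  then show ?thesis
    using layer by simp
qed

lemma annihilation_basic_eq_0:
  fixes K :: "(real ^ 'd) set"
  assumes "K \<subseteq> grid n" and "basic K" and "annihilation n K h" and "x \<in> K"
  shows "h x = 0"
proof -
  have fin: "finite K"
    using assms(1) finite_grid finite_subset by blast
  obtain u :: "'d \<Rightarrow> real \<Rightarrow> real"
    where u: "\<forall>x\<in>K. real_of_int (h x) = (\<Sum>i\<in>UNIV. u i (x $ i))"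
    using assms(2) unfolding basic_def by meson
  have "(\<Sum>x\<in>K. (real_of_int (h x))\<^sup>2) = (\<Sum>x\<in>K. real_of_int (h x) * (\<Sum>i\<in>UNIV. u i (x $ i)))"
    using u by (intro sum.cong) (auto simp: power2_eq_square)
  also have "\<dots> = (\<Sum>i\<in>UNIV. \<Sum>x\<in>K. real_of_int (h x) * u i (x $ i))"
    by (simp add: sum_distrib_left sum.swap[of _ UNIV K])
  also have "\<dots> = 0"
    using annihilation_orthogonal_coordinate[OF assms(1,3)] by simp
  finally have "(\<Sum>x\<in>K. (real_of_int (h x))\<^sup>2) = 0" .
  then show ?thesis
    using fin assms(4) by (simp add: sum_nonneg_eq_0_iff)
qed

theorem lemma1p6:
  fixes n :: nat and M :: "(real ^ 'd) set" and f g :: "real ^ 'd \<Rightarrow> int"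
  assumes "CARD('d) \<ge> 2"
    and "n \<ge> 1"
    and "M \<subseteq> grid n"
    and "minimal_nonbasic M"
    and "annihilation n M f" and "\<exists>x\<in>M. f x \<noteq> 0"
    and "annihilation n M g" and "\<exists>x\<in>M. g x \<noteq> 0"
  shows "\<exists>c :: real. \<forall>x\<in>M. real_of_int (g x) = c * real_of_int (f x)"
proof -
  obtain a where a: "a \<in> M" "f a \<noteq> 0"
    using assms(6) by blast
  define h where "h x = f a * g x + (- g a) * f x" for x
  have "annihilation n M h"
    unfolding h_def by (rule annihilation_linear_combination[OF assms(7,5)])
  moreover have "finite M"
    using assms(3) finite_grid finite_subset by blast
  moreover have "h a = 0"
    by (simp add: h_def)
  ultimately have ann: "annihilation n (M - {a}) h"
    by (intro annihilation_remove_zero)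
  have "M - {a} \<subset> M"
    using a(1) by blast
  then have bas: "basic (M - {a})"
    using assms(4) unfolding minimal_nonbasic_def by blast
  have sub: "M - {a} \<subseteq> grid n"
    using assms(3) by blast
  have "h x = 0" if "x \<in> M" for x
    using that \<open>h a = 0\<close> annihilation_basic_eq_0[OF sub bas ann] by (cases "x = a") auto
  then have eq: "f a * g x = g a * f x" if "x \<in> M" for x
    using that by (simp add: h_def)
  have "real_of_int (g x) = real_of_int (g a) / real_of_int (f a) * real_of_int (f x)"
    if "x \<in> M" for x
  proof -
    have "real_of_int (f a) * real_of_int (g x) = real_of_int (g a) * real_of_int (f x)"
      using eq[OF that] by (simp flip: of_int_mult)
    then show ?thesis
      using a(2) by (simp add: field_simps)
  qed
  then show ?thesis
    by blast
qed

end
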